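(* Let $(M,\phi,\xi,\eta,g)$ be an $LP$-Sasakian manifold with Levi-Civita connection $\nabla$, and let $\alpha,\beta$ be smooth functions on $M$. The generalized symmetric metric connection $\overline{\nabla}$ of type $(\alpha,\beta)$ on $M$ is given by $$\overline{\nabla}_UV=\nabla_UV+\alpha\{\eta(V)U-g(U,V)\xi\}+\beta\{\eta(V)\phi U-g(\phi U,V)\xi\}$$ for all vector fields $U,V$ on $M$.
   Context: An $LP$-Sasakian (Lorentzian para-Sasakian) manifold $(M,\phi,\xi,\eta,g)$ is a differentiable manifold with a $(1,1)$ tensor field $\phi$, a vector field $\xi$, a $1$-form $\eta$ and a Lorentzian metric $g$ with Levi-Civita connection $\nabla$ such that, for all vector fields $U,V$: $\eta(\xi)=-1$, $\phi^2U=U+\eta(U)\xi$, $g(\phi U,\phi V)=g(U,V)+\eta(U)\eta(V)$, $g(U,\xi)=\eta(U)$, $\nabla_U\xi=\phi U$, $(\nabla_U\phi)(V)=g(U,V)\xi+\eta(V)U+2\eta(U)\eta(V)\xi$. A generalized symmetric metric connection of type $(\alpha,\beta)$ on $M$ is a linear connection $\overline{\nabla}$ with $\overline{\nabla}g=0$ whose torsion tensor is $$T(U,V)=\alpha\{\eta(V)U-\eta(U)V\}+\beta\{\eta(V)\phi U-\eta(U)\phi V\}$$ for all vector fields $U,V$ on $M$. *)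

theory Defs
  imports "HOL-Analysis.Analysis" "HOL-Library.Function_Algebras"
begin

section \<open>Smooth maps between open subsets of Euclidean spaces\<close>

text \<open>\<open>S\<close> is meant to be open. \<open>f\<close> is of class \<open>C\<^sup>k\<^sup>+\<^sup>1\<close> iff it is differentiable
  and all its directional derivatives are of class \<open>C\<^sup>k\<close>.\<close>

primrec Ck_on :: "nat \<Rightarrow> ('e::euclidean_space \<Rightarrow> 'b::real_normed_vector) \<Rightarrow> 'e set \<Rightarrow> bool" where
  "Ck_on 0 f S \<longleftrightarrow> continuous_on S f"
| "Ck_on (Suc k) f S \<longleftrightarrow>
     (\<forall>x\<in>S. f differentiable (at x)) \<and> (\<forall>v. Ck_on k (\<lambda>x. frechet_derivative f (at x) v) S)"

definition smooth_on :: "('e::euclidean_space \<Rightarrow> 'b::real_normed_vector) \<Rightarrow> 'e set \<Rightarrow> bool" where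
  "smooth_on f S \<longleftrightarrow> (\<forall>k. Ck_on k f S)"


section \<open>Smooth manifolds\<close>

text \<open>The underlying space of the manifold is a whole type \<open>'a\<close>, its model space is \<open>'e\<close>, so
  that its dimension is \<open>DIM('e)\<close>. A chart \<open>(U, c)\<close> is a map \<open>c\<close> of which only the values on
  \<open>U\<close> matter. The atlas need not be maximal.\<close>

type_synonym ('a, 'e) atlas = "('a set \<times> ('a \<Rightarrow> 'e)) set"

locale smooth_manifold =
  fixes A :: "('a::{t2_space, second_countable_topology}, 'e::euclidean_space) atlas"
  assumes chart: "(U, c) \<in> A \<Longrightarrow>
      open U \<and> open (c ` U) \<and> homeomorphism U (c ` U) c (inv_into U c)"
    and cover: "(\<Union>(U, c)\<in>A. U) = UNIV"
    and compatible: "\<lbrakk>(U, c) \<in> A; (V, d) \<in> A\<rbrakk> \<Longrightarrow> smooth_on (d \<circ> inv_into U c) (c ` (U \<inter> V))"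

definition smooth_functions :: "('a, 'e::euclidean_space) atlas \<Rightarrow> ('a \<Rightarrow> real) set" where
  "smooth_functions A = {f. \<forall>(U, c)\<in>A. smooth_on (f \<circ> inv_into U c) (c ` U)}"


section \<open>Tangent vectors and vector fields\<close>

text \<open>Tangent vectors at \<open>p\<close> are the derivations at \<open>p\<close> of the algebra of smooth functions,
  extended by 0 to the functions that are not smooth, so that two tangent vectors are equal in
  HOL iff they agree on smooth functions. Sums and differences of tangent vectors, of vector
  fields and of functions are the pointwise ones.\<close>

type_synonym 'a tvec = "('a \<Rightarrow> real) \<Rightarrow> real"
type_synonym 'a vfield = "'a \<Rightarrow> 'a tvec"

definition tscale :: "real \<Rightarrow> 'a tvec \<Rightarrow> 'a tvec" where
  "tscale r v = (\<lambda>f. r * v f)"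

definition tangent_space :: "('a, 'e::euclidean_space) atlas \<Rightarrow> 'a \<Rightarrow> 'a tvec set" where
  "tangent_space A p = {v.
     (\<forall>f\<in>smooth_functions A. \<forall>h\<in>smooth_functions A. v (f + h) = v f + v h) \<and>
     (\<forall>r. \<forall>f\<in>smooth_functions A. v (\<lambda>x. r * f x) = r * v f) \<and>
     (\<forall>f\<in>smooth_functions A. \<forall>h\<in>smooth_functions A. v (f * h) = f p * v h + h p * v f) \<and>
     (\<forall>f. f \<notin> smooth_functions A \<longrightarrow> v f = 0)}"

definition deriv_along :: "'a vfield \<Rightarrow> ('a \<Rightarrow> real) \<Rightarrow> ('a \<Rightarrow> real)" where
  "deriv_along X f = (\<lambda>p. X p f)"

definition vector_fields :: "('a, 'e::euclidean_space) atlas \<Rightarrow> 'a vfield set" where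
  "vector_fields A = {X. (\<forall>p. X p \<in> tangent_space A p) \<and>
     (\<forall>f\<in>smooth_functions A. deriv_along X f \<in> smooth_functions A)}"

definition fscale :: "('a \<Rightarrow> real) \<Rightarrow> 'a vfield \<Rightarrow> 'a vfield" (infixr "\<odot>" 75) where
  "f \<odot> X = (\<lambda>p. tscale (f p) (X p))"

definition lie_bracket :: "'a vfield \<Rightarrow> 'a vfield \<Rightarrow> 'a vfield" where
  "lie_bracket X Y = (\<lambda>p f. X p (deriv_along Y f) - Y p (deriv_along X f))"


section \<open>Tensor fields\<close>

text \<open>Pointwise application of a tensor field to a vector field: \<open>\<eta> \<star> X\<close> is a function if
  \<open>\<eta>\<close> is a 1-form, \<open>\<phi> \<star> X\<close> is a vector field if \<open>\<phi>\<close> is a (1,1) tensor field, and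
  \<open>g \<star> X \<star> Y\<close> is a function if \<open>g\<close> is a (0,2) tensor field.\<close>

definition tapply :: "('a \<Rightarrow> 'a tvec \<Rightarrow> 'b) \<Rightarrow> 'a vfield \<Rightarrow> ('a \<Rightarrow> 'b)" (infixl "\<star>" 80) where
  "T \<star> X = (\<lambda>p. T p (X p))"

definition tangent_covector ::
    "('a, 'e::euclidean_space) atlas \<Rightarrow> 'a \<Rightarrow> ('a tvec \<Rightarrow> real) \<Rightarrow> bool" where
  "tangent_covector A p w \<longleftrightarrow>
     (\<forall>u\<in>tangent_space A p. \<forall>v\<in>tangent_space A p. w (u + v) = w u + w v) \<and>
     (\<forall>r. \<forall>v\<in>tangent_space A p. w (tscale r v) = r * w v)"

definition tangent_endomorphism ::
    "('a, 'e::euclidean_space) atlas \<Rightarrow> 'a \<Rightarrow> ('a tvec \<Rightarrow> 'a tvec) \<Rightarrow> bool" where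
  "tangent_endomorphism A p L \<longleftrightarrow>
     (\<forall>v\<in>tangent_space A p. L v \<in> tangent_space A p) \<and>
     (\<forall>u\<in>tangent_space A p. \<forall>v\<in>tangent_space A p. L (u + v) = L u + L v) \<and>
     (\<forall>r. \<forall>v\<in>tangent_space A p. L (tscale r v) = tscale r (L v))"

text \<open>A field of tensors is smooth iff it takes smooth vector fields to smooth functions or
  smooth vector fields.\<close>

definition one_form ::
    "('a, 'e::euclidean_space) atlas \<Rightarrow> ('a \<Rightarrow> 'a tvec \<Rightarrow> real) \<Rightarrow> bool" where
  "one_form A \<eta> \<longleftrightarrow> (\<forall>p. tangent_covector A p (\<eta> p)) \<and>
     (\<forall>X\<in>vector_fields A. \<eta> \<star> X \<in> smooth_functions A)"

definition tensor_field_11 ::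
    "('a, 'e::euclidean_space) atlas \<Rightarrow> ('a \<Rightarrow> 'a tvec \<Rightarrow> 'a tvec) \<Rightarrow> bool" where
  "tensor_field_11 A \<phi> \<longleftrightarrow> (\<forall>p. tangent_endomorphism A p (\<phi> p)) \<and>
     (\<forall>X\<in>vector_fields A. \<phi> \<star> X \<in> vector_fields A)"

definition tensor_field_02 ::
    "('a, 'e::euclidean_space) atlas \<Rightarrow> ('a \<Rightarrow> 'a tvec \<Rightarrow> 'a tvec \<Rightarrow> real) \<Rightarrow> bool" where
  "tensor_field_02 A g \<longleftrightarrow>
     (\<forall>p. \<forall>v\<in>tangent_space A p. tangent_covector A p (g p v)
                            \<and> tangent_covector A p (\<lambda>u. g p u v)) \<and>
     (\<forall>X\<in>vector_fields A. \<forall>Y\<in>vector_fields A. g \<star> X \<star> Y \<in> smooth_functions A)"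

text \<open>Signature \<open>(-, +, \<dots>, +)\<close>: the tangent space at each point has a basis
  \<open>E 0, \<dots>, E (n - 1)\<close> whose Gram matrix is \<open>diag (-1, 1, \<dots>, 1)\<close>. It suffices to require
  that it spans, because orthonormality implies linear independence.\<close>

definition lorentzian_metric ::
    "('a, 'e::euclidean_space) atlas \<Rightarrow> ('a \<Rightarrow> 'a tvec \<Rightarrow> 'a tvec \<Rightarrow> real) \<Rightarrow> bool" where
  "lorentzian_metric A g \<longleftrightarrow> tensor_field_02 A g \<and>
     (\<forall>p. \<forall>u\<in>tangent_space A p. \<forall>v\<in>tangent_space A p. g p u v = g p v u) \<and>
     (\<forall>p. \<exists>E :: nat \<Rightarrow> 'a tvec.
        (\<forall>i<DIM('e). E i \<in> tangent_space A p) \<and>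
        (\<forall>v\<in>tangent_space A p. \<exists>c :: nat \<Rightarrow> real. v = (\<Sum>i<DIM('e). tscale (c i) (E i))) \<and>
        (\<forall>i<DIM('e). \<forall>j<DIM('e).
           g p (E i) (E j) = (if i = j then (if i = 0 then -1 else 1) else 0)))"


section \<open>Linear connections\<close>

text \<open>A connection is an operator on smooth vector fields; its values on other arguments are
  irrelevant.\<close>

type_synonym 'a connection = "'a vfield \<Rightarrow> 'a vfield \<Rightarrow> 'a vfield"

definition linear_connection :: "('a, 'e::euclidean_space) atlas \<Rightarrow> 'a connection \<Rightarrow> bool" where
  "linear_connection A D \<longleftrightarrow>
     (\<forall>X\<in>vector_fields A. \<forall>Y\<in>vector_fields A. D X Y \<in> vector_fields A) \<and>
     (\<forall>X\<in>vector_fields A. \<forall>Y\<in>vector_fields A. \<forall>Z\<in>vector_fields A.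
        D (X + Y) Z = D X Z + D Y Z \<and> D X (Y + Z) = D X Y + D X Z) \<and>
     (\<forall>f\<in>smooth_functions A. \<forall>X\<in>vector_fields A. \<forall>Y\<in>vector_fields A.
        D (f \<odot> X) Y = f \<odot> D X Y \<and> D X (f \<odot> Y) = deriv_along X f \<odot> Y + f \<odot> D X Y)"

definition torsion :: "'a connection \<Rightarrow> 'a vfield \<Rightarrow> 'a vfield \<Rightarrow> 'a vfield" where
  "torsion D X Y = D X Y - D Y X - lie_bracket X Y"

text \<open>\<open>(D\<^sub>X g)(Y, Z)\<close> and \<open>(D\<^sub>X \<phi>)(Y)\<close>.\<close>

definition cov_deriv_02 ::
    "'a connection \<Rightarrow> ('a \<Rightarrow> 'a tvec \<Rightarrow> 'a tvec \<Rightarrow> real) \<Rightarrow>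
     'a vfield \<Rightarrow> 'a vfield \<Rightarrow> 'a vfield \<Rightarrow> ('a \<Rightarrow> real)" where
  "cov_deriv_02 D g X Y Z = deriv_along X (g \<star> Y \<star> Z) - g \<star> D X Y \<star> Z - g \<star> Y \<star> D X Z"

definition cov_deriv_11 ::
    "'a connection \<Rightarrow> ('a \<Rightarrow> 'a tvec \<Rightarrow> 'a tvec) \<Rightarrow> 'a vfield \<Rightarrow> 'a vfield \<Rightarrow> 'a vfield" where
  "cov_deriv_11 D \<phi> X Y = D X (\<phi> \<star> Y) - \<phi> \<star> D X Y"

definition metric_connection ::
    "('a, 'e::euclidean_space) atlas \<Rightarrow> ('a \<Rightarrow> 'a tvec \<Rightarrow> 'a tvec \<Rightarrow> real) \<Rightarrow>
     'a connection \<Rightarrow> bool" where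
  "metric_connection A g D \<longleftrightarrow> linear_connection A D \<and>
     (\<forall>X\<in>vector_fields A. \<forall>Y\<in>vector_fields A. \<forall>Z\<in>vector_fields A. cov_deriv_02 D g X Y Z = 0)"

definition levi_civita_connection ::
    "('a, 'e::euclidean_space) atlas \<Rightarrow> ('a \<Rightarrow> 'a tvec \<Rightarrow> 'a tvec \<Rightarrow> real) \<Rightarrow>
     'a connection \<Rightarrow> bool" where
  "levi_civita_connection A g D \<longleftrightarrow> metric_connection A g D \<and>
     (\<forall>X\<in>vector_fields A. \<forall>Y\<in>vector_fields A. torsion D X Y = 0)"


section \<open>Lorentzian para-Sasakian manifolds\<close>

locale lp_sasakian_manifold = smooth_manifold A
  for A :: "('a::{t2_space, second_countable_topology}, 'e::euclidean_space) atlas" +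
  fixes \<phi> :: "'a \<Rightarrow> 'a tvec \<Rightarrow> 'a tvec"
    and \<xi> :: "'a vfield"
    and \<eta> :: "'a \<Rightarrow> 'a tvec \<Rightarrow> real"
    and g :: "'a \<Rightarrow> 'a tvec \<Rightarrow> 'a tvec \<Rightarrow> real"
    and nabla :: "'a connection"
  assumes phi_tensor: "tensor_field_11 A \<phi>"
    and xi_field: "\<xi> \<in> vector_fields A"
    and eta_form: "one_form A \<eta>"
    and g_lorentzian: "lorentzian_metric A g"
    and nabla_levi_civita: "levi_civita_connection A g nabla"
    and eta_xi: "\<eta> \<star> \<xi> = - 1"
    and phi_phi: "U \<in> vector_fields A \<Longrightarrow> \<phi> \<star> (\<phi> \<star> U) = U + (\<eta> \<star> U) \<odot> \<xi>"
    and g_phi_phi: "\<lbrakk>U \<in> vector_fields A; V \<in> vector_fields A\<rbrakk> \<Longrightarrow>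
      g \<star> (\<phi> \<star> U) \<star> (\<phi> \<star> V) = g \<star> U \<star> V + (\<eta> \<star> U) * (\<eta> \<star> V)"
    and g_xi: "U \<in> vector_fields A \<Longrightarrow> g \<star> U \<star> \<xi> = \<eta> \<star> U"
    and nabla_xi: "U \<in> vector_fields A \<Longrightarrow> nabla U \<xi> = \<phi> \<star> U"
    and nabla_phi: "\<lbrakk>U \<in> vector_fields A; V \<in> vector_fields A\<rbrakk> \<Longrightarrow>
      cov_deriv_11 nabla \<phi> U V =
        (g \<star> U \<star> V) \<odot> \<xi> + (\<eta> \<star> V) \<odot> U + (\<lambda>p. 2 * (\<eta> \<star> U) p * (\<eta> \<star> V) p) \<odot> \<xi>"

definition generalized_symmetric_metric_connection ::
    "('a, 'e::euclidean_space) atlas \<Rightarrow> ('a \<Rightarrow> 'a tvec \<Rightarrow> 'a tvec) \<Rightarrow>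
     ('a \<Rightarrow> 'a tvec \<Rightarrow> real) \<Rightarrow> ('a \<Rightarrow> 'a tvec \<Rightarrow> 'a tvec \<Rightarrow> real) \<Rightarrow>
     ('a \<Rightarrow> real) \<Rightarrow> ('a \<Rightarrow> real) \<Rightarrow> 'a connection \<Rightarrow> bool" where
  "generalized_symmetric_metric_connection A \<phi> \<eta> g \<alpha> \<beta> D \<longleftrightarrow>
     metric_connection A g D \<and>
     (\<forall>U\<in>vector_fields A. \<forall>V\<in>vector_fields A.
        torsion D U V =
          \<alpha> \<odot> ((\<eta> \<star> V) \<odot> U - (\<eta> \<star> U) \<odot> V) +
          \<beta> \<odot> ((\<eta> \<star> V) \<odot> (\<phi> \<star> U) - (\<eta> \<star> U) \<odot> (\<phi> \<star> V)))"

end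

theory Submission
  imports Defs
begin

text \<open>A metric connection is determined by its torsion, so it suffices to check that the
  formula itself defines a connection of type (\<alpha>, \<beta>). Write it as
  \<open>nabla U V\<close> + S(U, V). The tensor S is bilinear over smooth functions, so the sum is
  a linear connection; g(S(U, V), Z) is skew in V and Z, so the sum stays metric; and as
  \<open>nabla\<close> is torsion-free, the new torsion is S(U, V) - S(V, U), where the \<xi>-terms
  cancel by symmetry of g(U, V) and g(\<phi> U, V). This is
  \<open>explicit_connection_is_generalized_symmetric\<close>. Symmetry of g(\<phi> U, V) is
  \<open>phi_self_adjoint\<close>, obtained from the structure equations through \<phi> \<xi> = 0
  and \<eta>(\<phi> U) = 0.

  Uniqueness is \<open>metric_connection_unique\<close>. It needs g to be nondegenerate when tested
  on global fields only (\<open>g_nondegenerate\<close>), which the pointwise lemma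
  \<open>lorentzian_orthogonal_timelike\<close> provides. The C^k calculus serves to show that
  smooth fields are closed under the operations in the formula.\<close>

section \<open>The algebra of smooth functions\<close>

text \<open>A derivative at a point of an open set depends only on the values nearby. This lets the
  sum and product rules, which hold only at points of \<open>S\<close>, replace the derivative
  inside \<open>Ck_on\<close>.\<close>

lemma Ck_on_cong:
  assumes "open S" and "\<And>x. x \<in> S \<Longrightarrow> f x = h x"
  shows "Ck_on k f S \<longleftrightarrow> Ck_on k h S"
  using assms
proof (induction k arbitrary: f h)
  case 0
  then show ?case
    by (auto intro: continuous_on_cong)
next
  case (Suc k)
  have *: "(f has_derivative f') (at x) \<longleftrightarrow> (h has_derivative f') (at x)" if "x \<in> S" for f' x
    using that Suc.prems by (metis has_derivative_transform_within_open)
  have "frechet_derivative f (at x) = frechet_derivative h (at x)" if "x \<in> S" for x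
    using * that by (simp add: frechet_derivative_def)
  moreover have "f differentiable (at x) \<longleftrightarrow> h differentiable (at x)" if "x \<in> S" for x
    using * that by (simp add: differentiable_def)
  moreover have "Ck_on k (\<lambda>x. frechet_derivative f (at x) v) S
      \<longleftrightarrow> Ck_on k (\<lambda>x. frechet_derivative h (at x) v) S" for v
    by (rule Suc.IH) (simp_all add: Suc.prems(1) calculation(1))
  ultimately show ?case
    by simp
qed

text \<open>The definition of C^(k+1) does not mention the map itself being C^k. The induction
  descends to directional derivatives and starts from the continuity of differentiable maps.\<close>

lemma Ck_on_SucD: "Ck_on (Suc k) f S \<Longrightarrow> Ck_on k f S"
proof (induction k arbitrary: f)
  case 0
  then show ?case
    by (simp add: differentiable_imp_continuous_on differentiable_at_imp_differentiable_on)
next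
  case (Suc k)
  then show ?case
    by (metis Ck_on.simps(2))
qed

lemma Ck_on_add:
  assumes "open S" "Ck_on k f S" "Ck_on k h S"
  shows "Ck_on k (\<lambda>x. f x + h x) S"
  using assms
proof (induction k arbitrary: f h)
  case 0
  then show ?case
    by (simp add: continuous_on_add)
next
  case (Suc k)
  let ?d = "\<lambda>v x. frechet_derivative f (at x) v + frechet_derivative h (at x) v"
  have "frechet_derivative (\<lambda>x. f x + h x) (at x) v = ?d v x" if "x \<in> S" for x v
    using Suc.prems that
    by (intro frechet_derivative_at[symmetric, THEN fun_cong] has_derivative_add)
       (auto simp: frechet_derivative_works[symmetric])
  moreover have "Ck_on k (?d v) S" for v
    using Suc by simp
  ultimately have "Ck_on k (\<lambda>x. frechet_derivative (\<lambda>x. f x + h x) (at x) v) S" for v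
    using Suc.prems(1) by (simp cong: Ck_on_cong)
  then show ?case
    using Suc.prems by simp
qed

lemma Ck_on_mult:
  fixes f h :: "'e::euclidean_space \<Rightarrow> 'b::real_normed_algebra"
  assumes "open S" "Ck_on k f S" "Ck_on k h S"
  shows "Ck_on k (\<lambda>x. f x * h x) S"
  using assms
proof (induction k arbitrary: f h)
  case 0
  then show ?case
    by (simp add: continuous_on_mult)
next
  case (Suc k)
  let ?d = "\<lambda>v x. f x * frechet_derivative h (at x) v + frechet_derivative f (at x) v * h x"
  have "frechet_derivative (\<lambda>x. f x * h x) (at x) v = ?d v x" if "x \<in> S" for x v
    using Suc.prems that
    by (intro frechet_derivative_at[symmetric, THEN fun_cong] has_derivative_mult)
       (auto simp: frechet_derivative_works[symmetric])
  \<comment> \<open>Each term of the Leibniz rule has an undifferentiated factor, of class C^(k+1);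
    \<open>Ck_on_SucD\<close> lowers it to C^k, so that the induction hypothesis applies.\<close>
  moreover have "Ck_on k (?d v) S" for v
  proof (rule Ck_on_add)
    show "Ck_on k (\<lambda>x. f x * frechet_derivative h (at x) v) S"
      using Suc Ck_on_SucD[OF Suc.prems(2)] by simp
    show "Ck_on k (\<lambda>x. frechet_derivative f (at x) v * h x) S"
      using Suc Ck_on_SucD[OF Suc.prems(3)] by simp
  qed (fact Suc.prems(1))
  ultimately have "Ck_on k (\<lambda>x. frechet_derivative (\<lambda>x. f x * h x) (at x) v) S" for v
    using Suc.prems(1) by (simp cong: Ck_on_cong)
  then show ?case
    using Suc.prems by simp
qed

lemma Ck_on_const: "Ck_on k (\<lambda>x. c) S"
  by (induction k arbitrary: c) auto

context smooth_manifold
begin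

lemma open_chart_image: "(U, c) \<in> A \<Longrightarrow> open (c ` U)"
  using chart by blast

lemma smooth_functions_add:
  "\<lbrakk>f \<in> smooth_functions A; h \<in> smooth_functions A\<rbrakk> \<Longrightarrow> f + h \<in> smooth_functions A"
  by (auto simp: smooth_functions_def smooth_on_def comp_def intro!: Ck_on_add open_chart_image)

lemma smooth_functions_mult:
  "\<lbrakk>f \<in> smooth_functions A; h \<in> smooth_functions A\<rbrakk> \<Longrightarrow> f * h \<in> smooth_functions A"
  by (auto simp: smooth_functions_def smooth_on_def comp_def intro!: Ck_on_mult open_chart_image)

lemma smooth_functions_const: "(\<lambda>x. r) \<in> smooth_functions A"
  by (auto simp: smooth_functions_def smooth_on_def comp_def Ck_on_const)


section \<open>The module of vector fields\<close>

lemma tangent_space_add: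
  "\<lbrakk>u \<in> tangent_space A p; v \<in> tangent_space A p\<rbrakk> \<Longrightarrow> u + v \<in> tangent_space A p"
  by (simp add: tangent_space_def algebra_simps)

lemma tangent_space_tscale: "v \<in> tangent_space A p \<Longrightarrow> tscale r v \<in> tangent_space A p"
  by (simp add: tangent_space_def tscale_def algebra_simps)

lemma diff_conv_tscale: "u - v = u + tscale (- 1) v"
  by (simp add: tscale_def fun_eq_iff)

lemma vector_fieldsD: "X \<in> vector_fields A \<Longrightarrow> X p \<in> tangent_space A p"
  by (simp add: vector_fields_def)

lemma vector_fields_add:
  assumes "X \<in> vector_fields A" "Y \<in> vector_fields A"
  shows "X + Y \<in> vector_fields A"
proof -
  have "deriv_along (X + Y) f = deriv_along X f + deriv_along Y f" for f
    by (simp add: deriv_along_def fun_eq_iff)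
  with assms show ?thesis
    by (simp add: vector_fields_def tangent_space_add smooth_functions_add)
qed

lemma vector_fields_fscale:
  assumes "f \<in> smooth_functions A" "X \<in> vector_fields A"
  shows "f \<odot> X \<in> vector_fields A"
proof -
  have "deriv_along (f \<odot> X) h = f * deriv_along X h" for h
    by (simp add: deriv_along_def fscale_def tscale_def fun_eq_iff)
  with assms show ?thesis
    by (simp add: vector_fields_def fscale_def tangent_space_tscale smooth_functions_mult)
qed

lemma vector_fields_diff:
  assumes "X \<in> vector_fields A" "Y \<in> vector_fields A"
  shows "X - Y \<in> vector_fields A"
proof -
  have "X - Y = X + (\<lambda>x. - 1) \<odot> Y"
    by (simp add: fscale_def tscale_def fun_eq_iff)
  also have "\<dots> \<in> vector_fields A"
    using assms by (intro vector_fields_add vector_fields_fscale smooth_functions_const)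
  finally show ?thesis .
qed


section \<open>Lorentzian metrics\<close>

lemma tensor_02_add:
  assumes "tensor_field_02 A h" "u \<in> tangent_space A p" "v \<in> tangent_space A p"
    "w \<in> tangent_space A p"
  shows tensor_02_add_left: "h p (u + v) w = h p u w + h p v w"
    and tensor_02_add_right: "h p w (u + v) = h p w u + h p w v"
  using assms by (auto simp: tensor_field_02_def tangent_covector_def)

lemma tensor_02_tscale:
  assumes "tensor_field_02 A h" "v \<in> tangent_space A p" "w \<in> tangent_space A p"
  shows tensor_02_tscale_left: "h p (tscale r v) w = r * h p v w"
    and tensor_02_tscale_right: "h p w (tscale r v) = r * h p w v"
  using assms by (auto simp: tensor_field_02_def tangent_covector_def)

lemma zero_conv_tscale: "0 = tscale 0 v"
  by (simp add: tscale_def fun_eq_iff)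

lemma tangent_space_zero: "0 \<in> tangent_space A p"
  by (simp add: tangent_space_def)

lemma tangent_space_sum:
  "(\<And>i. i \<in> I \<Longrightarrow> v i \<in> tangent_space A p) \<Longrightarrow> (\<Sum>i\<in>I. v i) \<in> tangent_space A p"
  by (induction I rule: infinite_finite_induct) (auto simp: tangent_space_zero tangent_space_add)

lemma tensor_02_sum_left:
  assumes "tensor_field_02 A h" "\<And>i. i \<in> I \<Longrightarrow> v i \<in> tangent_space A p"
    "w \<in> tangent_space A p"
  shows "h p (\<Sum>i\<in>I. tscale (a i) (v i)) w = (\<Sum>i\<in>I. a i * h p (v i) w)"
proof -
  \<comment> \<open>Sums over empty or infinite index sets are 0, so these cases of the induction
    reduce to this one.\<close>
  have zero: "h p 0 w = 0"
    using tensor_02_tscale_left[OF assms(1) tangent_space_zero assms(3), of 0]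
    by (simp flip: zero_conv_tscale)
  from assms(2) show ?thesis
  proof (induction I rule: infinite_finite_induct)
    case (insert i I)
    have "h p (\<Sum>j\<in>insert i I. tscale (a j) (v j)) w
        = h p (tscale (a i) (v i)) w + h p (\<Sum>j\<in>I. tscale (a j) (v j)) w"
      unfolding sum.insert[OF insert.hyps(1,2)] using insert.prems
      by (intro tensor_02_add_left[OF assms(1)] tangent_space_sum tangent_space_tscale assms(3)) auto
    also have "\<dots> = (\<Sum>j\<in>insert i I. a j * h p (v j) w)"
      using insert assms(1,3) by (simp add: tensor_02_tscale_left)
    finally show ?case .
  qed (simp_all add: zero)
qed

lemma tensor_02_sum_right:
  assumes "tensor_field_02 A h" "\<And>i. i \<in> I \<Longrightarrow> v i \<in> tangent_space A p"
    "w \<in> tangent_space A p"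
  shows "h p w (\<Sum>i\<in>I. tscale (a i) (v i)) = (\<Sum>i\<in>I. a i * h p w (v i))"
proof -
  \<comment> \<open>The transposed tensor turns expansion in the second argument into expansion in
    the first.\<close>
  have "tensor_field_02 A (\<lambda>p u v. h p v u)"
    using assms(1) by (auto simp: tensor_field_02_def tapply_def)
  from tensor_02_sum_left[OF this assms(2,3)] show ?thesis .
qed

text \<open>The usual Cauchy-Schwarz inequality for the spacelike coordinates in a Lorentz frame
  forces the timelike coordinate of \<open>w\<close> to vanish.\<close>

lemma lorentzian_orthogonal_timelike:
  assumes h: "lorentzian_metric A h"
    and x: "x \<in> tangent_space A p" "h p x x < 0"
    and w: "w \<in> tangent_space A p" "h p w x = 0" "h p w w \<le> 0"
  shows "w = 0"
proof -
  let ?n = "DIM('e)"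
  have tensor: "tensor_field_02 A h"
    using h by (simp add: lorentzian_metric_def)
  obtain E where E: "\<forall>i<?n. E i \<in> tangent_space A p"
    and span: "\<forall>v\<in>tangent_space A p. \<exists>c. v = (\<Sum>i<?n. tscale (c i) (E i))"
    and gram: "\<forall>i<?n. \<forall>j<?n.
      h p (E i) (E j) = (if i = j then (if i = 0 then -1 else 1) else 0)"
    using h unfolding lorentzian_metric_def by blast
  obtain a where a: "w = (\<Sum>i<?n. tscale (a i) (E i))"
    using span w(1) by blast
  obtain b where b: "x = (\<Sum>i<?n. tscale (b i) (E i))"
    using span x(1) by blast
  \<comment> \<open>Separates the timelike index 0, which exists because the dimension is
    positive.\<close>
  have split: "{..<?n} = insert 0 {1..<?n}"
    using DIM_positive[where 'a = 'e] by auto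
  have inner: "h p (\<Sum>i<?n. tscale (c i) (E i)) (\<Sum>i<?n. tscale (d i) (E i))
      = (\<Sum>i=1..<?n. c i * d i) - c 0 * d 0" for c d
  proof -
    have "h p (\<Sum>i<?n. tscale (c i) (E i)) (\<Sum>i<?n. tscale (d i) (E i))
        = (\<Sum>i<?n. c i * h p (E i) (\<Sum>j<?n. tscale (d j) (E j)))"
      using E by (intro tensor_02_sum_left[OF tensor] tangent_space_sum tangent_space_tscale) auto
    also have "\<dots> = (\<Sum>i<?n. c i * (\<Sum>j<?n. d j * h p (E i) (E j)))"
      using E by (intro sum.cong refl arg_cong2[where f = "(*)"] tensor_02_sum_right[OF tensor]) auto
    also have "\<dots> = (\<Sum>i<?n. c i * (\<Sum>j<?n. if i = j then d i * (if i = 0 then -1 else 1) else 0))"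
      by (intro sum.cong refl arg_cong2[where f = "(*)"]) (auto simp: gram)
    also have "\<dots> = (\<Sum>i<?n. c i * d i * (if i = 0 then -1 else 1))"
      by (intro sum.cong) auto
    also have "\<dots> = (\<Sum>i=1..<?n. c i * d i) - c 0 * d 0"
      unfolding split by simp
    finally show ?thesis .
  qed
  let ?S = "\<lambda>c d. \<Sum>i=1..<?n. c i * d i :: real"
  have ww: "?S a a \<le> a 0 * a 0" and xx: "?S b b < b 0 * b 0" and wx: "?S a b = a 0 * b 0"
    using w(2,3) x(2) by (simp_all add: a b inner)
  have "(a 0 * b 0)\<^sup>2 \<le> ?S a a * ?S b b"
    using Cauchy_Schwarz_ineq_sum[of a b "{1..<?n}"] by (simp add: wx[symmetric] power2_eq_square)
  also have "\<dots> \<le> (a 0 * a 0) * ?S b b"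
    using ww by (intro mult_right_mono sum_nonneg) auto
  finally have "(a 0 * a 0) * (b 0 * b 0) \<le> (a 0 * a 0) * ?S b b"
    by (simp add: power2_eq_square mult_ac)
  \<comment> \<open>Multiplying the strict inequality \<open>xx\<close> by a positive
    \<open>a 0 * a 0\<close> would contradict the bound just derived.\<close>
  with xx have "\<not> 0 < a 0 * a 0"
    using mult_strict_left_mono[OF xx, of "a 0 * a 0"] by linarith
  then have a0: "a 0 = 0"
    by (simp add: zero_less_mult_iff linorder_neq_iff)
  with ww have "?S a a = 0"
    by (simp add: antisym sum_nonneg)
  then have "\<forall>i\<in>{1..<?n}. a i * a i = 0"
    by (subst (asm) sum_nonneg_eq_0_iff) auto
  with a0 split have "\<And>i. i < ?n \<Longrightarrow> a i = 0"
    by (metis insert_iff lessThan_iff mult_eq_0_iff)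
  then show ?thesis
    unfolding a by (intro sum.neutral) (simp flip: zero_conv_tscale)
qed

end


section \<open>Algebra of the structure tensors\<close>

context lp_sasakian_manifold
begin

lemma g_tensor: "tensor_field_02 A g"
  using g_lorentzian by (simp add: lorentzian_metric_def)

text \<open>Discharges the membership conditions of the linearity rules for \<phi>, \<eta> and g
  during simplification.\<close>

lemma field_closure [simp, intro]:
  "\<xi> \<in> vector_fields A"
  "\<lbrakk>X \<in> vector_fields A; Y \<in> vector_fields A\<rbrakk> \<Longrightarrow> X + Y \<in> vector_fields A"
  "\<lbrakk>X \<in> vector_fields A; Y \<in> vector_fields A\<rbrakk> \<Longrightarrow> X - Y \<in> vector_fields A"
  "\<lbrakk>f \<in> smooth_functions A; X \<in> vector_fields A\<rbrakk> \<Longrightarrow> f \<odot> X \<in> vector_fields A"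
  "X \<in> vector_fields A \<Longrightarrow> \<phi> \<star> X \<in> vector_fields A"
  "X \<in> vector_fields A \<Longrightarrow> \<eta> \<star> X \<in> smooth_functions A"
  "\<lbrakk>X \<in> vector_fields A; Y \<in> vector_fields A\<rbrakk> \<Longrightarrow> g \<star> X \<star> Y \<in> smooth_functions A"
  using xi_field phi_tensor eta_form g_tensor
  by (auto simp: vector_fields_add vector_fields_diff vector_fields_fscale
      tensor_field_11_def one_form_def tensor_field_02_def)

lemma phi_add [simp]:
  assumes "X \<in> vector_fields A" "Y \<in> vector_fields A"
  shows "\<phi> \<star> (X + Y) = \<phi> \<star> X + \<phi> \<star> Y"
  using phi_tensor assms[THEN vector_fieldsD]
  by (simp_all add: tensor_field_11_def tangent_endomorphism_def tapply_def fscale_def fun_eq_iff)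

lemma phi_fscale [simp]:
  assumes "X \<in> vector_fields A"
  shows "\<phi> \<star> (f \<odot> X) = f \<odot> (\<phi> \<star> X)"
  using phi_tensor assms[THEN vector_fieldsD]
  by (simp_all add: tensor_field_11_def tangent_endomorphism_def tapply_def fscale_def fun_eq_iff)

lemma eta_add [simp]:
  assumes "X \<in> vector_fields A" "Y \<in> vector_fields A"
  shows "\<eta> \<star> (X + Y) = \<eta> \<star> X + \<eta> \<star> Y"
  using eta_form assms[THEN vector_fieldsD]
  by (simp_all add: one_form_def tangent_covector_def tapply_def fscale_def fun_eq_iff)

lemma eta_fscale [simp]:
  assumes "X \<in> vector_fields A"
  shows "\<eta> \<star> (f \<odot> X) = f * (\<eta> \<star> X)"
  using eta_form assms[THEN vector_fieldsD]
  by (simp_all add: one_form_def tangent_covector_def tapply_def fscale_def fun_eq_iff)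

lemma g_add_diff [simp]:
  assumes "X \<in> vector_fields A" "Y \<in> vector_fields A" "Z \<in> vector_fields A"
  shows "g \<star> (X + Y) \<star> Z = g \<star> X \<star> Z + g \<star> Y \<star> Z"
    "g \<star> Z \<star> (X + Y) = g \<star> Z \<star> X + g \<star> Z \<star> Y"
    "g \<star> (X - Y) \<star> Z = g \<star> X \<star> Z - g \<star> Y \<star> Z"
    "g \<star> Z \<star> (X - Y) = g \<star> Z \<star> X - g \<star> Z \<star> Y"
  using assms[THEN vector_fieldsD]
  by (simp_all add: diff_conv_tscale tapply_def fun_eq_iff tangent_space_tscale
      tensor_02_add[OF g_tensor] tensor_02_tscale[OF g_tensor])

lemma g_fscale [simp]:
  assumes "X \<in> vector_fields A" "Z \<in> vector_fields A"
  shows "g \<star> (f \<odot> X) \<star> Z = f * (g \<star> X \<star> Z)"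
    "g \<star> Z \<star> (f \<odot> X) = f * (g \<star> Z \<star> X)"
  using assms[THEN vector_fieldsD]
  by (simp_all add: tapply_def fscale_def fun_eq_iff tensor_02_tscale[OF g_tensor])

lemma g_sym:
  "\<lbrakk>X \<in> vector_fields A; Y \<in> vector_fields A\<rbrakk> \<Longrightarrow> g \<star> X \<star> Y = g \<star> Y \<star> X"
  using g_lorentzian by (simp add: lorentzian_metric_def tapply_def fun_eq_iff vector_fieldsD)

lemma g_xi_left: "X \<in> vector_fields A \<Longrightarrow> g \<star> \<xi> \<star> X = \<eta> \<star> X"
  by (simp add: g_sym[of \<xi>] g_xi)

text \<open>A field orthogonal to all fields is orthogonal to itself and to the timelike field
  \<open>\<xi>\<close>; this avoids extending tangent vectors to vector fields.\<close>

lemma g_nondegenerate: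
  assumes "W \<in> vector_fields A" "\<And>Z. Z \<in> vector_fields A \<Longrightarrow> g \<star> W \<star> Z = 0"
  shows "W = 0"
proof
  fix p
  have "g p (\<xi> p) (\<xi> p) = - 1"
    using g_xi[of \<xi>] eta_xi by (simp add: tapply_def fun_eq_iff)
  moreover have "g p (W p) (\<xi> p) = 0" "g p (W p) (W p) = 0"
    using assms by (simp_all add: tapply_def fun_eq_iff)
  ultimately show "W p = 0 p"
    using lorentzian_orthogonal_timelike[OF g_lorentzian, of "\<xi> p" p "W p"] assms(1)
    by (simp add: vector_fieldsD)
qed

text \<open>By \<open>g_phi_phi\<close>, g(\<phi> U, \<phi> \<xi>) = \<eta>(U) + \<eta>(U)
  \<eta>(\<xi>) = 0, so \<phi> \<xi> is orthogonal to the image of \<phi>. As \<phi>(\<phi> Z) = Z +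
  \<eta>(Z) \<xi>, it is orthogonal to every Z once \<eta>(\<phi> \<xi>) = 0.\<close>

lemma phi_xi: "\<phi> \<star> \<xi> = 0"
proof (rule g_nondegenerate)
  fix Z assume Z: "Z \<in> vector_fields A"
  have orth: "g \<star> (\<phi> \<star> U) \<star> (\<phi> \<star> \<xi>) = 0" if "U \<in> vector_fields A" for U
    using that by (simp add: g_phi_phi g_xi eta_xi)
  \<comment> \<open>Put W = \<phi> \<xi>. Both W and \<phi>(\<phi> W) = W + \<eta>(W) \<xi> lie in
    the image of \<phi>, so both are orthogonal to W; the difference of the two equations is
    \<eta>(W) squared.\<close>
  have ker: "(\<eta> \<star> (\<phi> \<star> \<xi>)) * (\<eta> \<star> (\<phi> \<star> \<xi>)) = 0"
    using orth[of \<xi>] orth[of "\<phi> \<star> (\<phi> \<star> \<xi>)"] by (simp add: phi_phi[of "\<phi> \<star> \<xi>"] g_xi_left)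
  have "g \<star> (\<phi> \<star> (\<phi> \<star> Z)) \<star> (\<phi> \<star> \<xi>) = 0"
    using Z orth by simp
  then have "g \<star> Z \<star> (\<phi> \<star> \<xi>) + (\<eta> \<star> Z) * (\<eta> \<star> (\<phi> \<star> \<xi>)) = 0"
    using Z by (simp add: phi_phi g_xi_left)
  moreover have "\<eta> \<star> (\<phi> \<star> \<xi>) = 0"
    using ker by (simp add: fun_eq_iff)
  ultimately show "g \<star> (\<phi> \<star> \<xi>) \<star> Z = 0"
    using Z by (simp add: g_sym[of _ Z])
qed simp

text \<open>Compute the cube of \<phi> on U in two ways, as the square applied to \<phi> U and as
  \<phi> applied to the square. Since \<phi> \<xi> = 0, comparison leaves \<eta>(\<phi> U) \<xi> =
  0.\<close>

lemma eta_phi: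
  assumes "U \<in> vector_fields A"
  shows "\<eta> \<star> (\<phi> \<star> U) = 0"
proof -
  have "\<phi> \<star> U + (\<eta> \<star> (\<phi> \<star> U)) \<odot> \<xi> = \<phi> \<star> (\<phi> \<star> (\<phi> \<star> U))"
    using assms by (simp add: phi_phi[of "\<phi> \<star> U"])
  also have "\<dots> = \<phi> \<star> U + (\<eta> \<star> U) \<odot> (\<phi> \<star> \<xi>)"
    using assms by (simp add: phi_phi[of U])
  also have "\<dots> = \<phi> \<star> U"
    by (simp add: phi_xi fscale_def tscale_def fun_eq_iff)
  \<comment> \<open>The zero field is written as a multiple of \<xi> so that
    \<open>eta_fscale\<close> evaluates both sides.\<close>
  finally have "(\<eta> \<star> (\<phi> \<star> U)) \<odot> \<xi> = 0 \<odot> \<xi>"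
    by (simp add: fscale_def tscale_def fun_eq_iff)
  then have "\<eta> \<star> ((\<eta> \<star> (\<phi> \<star> U)) \<odot> \<xi>) = \<eta> \<star> (0 \<odot> \<xi>)"
    by (rule arg_cong)
  then show ?thesis
    by (simp add: eta_xi)
qed

text \<open>Replacing V by \<phi>(\<phi> V) adds only a multiple of g(\<phi> U, \<xi>) =
  \<eta>(\<phi> U) = 0; then \<open>g_phi_phi\<close> removes one \<phi> from each side.\<close>

lemma phi_self_adjoint:
  assumes "U \<in> vector_fields A" "V \<in> vector_fields A"
  shows "g \<star> (\<phi> \<star> U) \<star> V = g \<star> (\<phi> \<star> V) \<star> U"
proof -
  have "g \<star> (\<phi> \<star> U) \<star> V = g \<star> (\<phi> \<star> U) \<star> (\<phi> \<star> (\<phi> \<star> V))"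
    using assms by (simp add: phi_phi g_xi eta_phi)
  also have "\<dots> = g \<star> U \<star> (\<phi> \<star> V)"
    using assms by (simp add: g_phi_phi eta_phi)
  finally show ?thesis
    using assms by (simp add: g_sym)
qed


section \<open>Metric connections with prescribed torsion\<close>

lemma metric_connection_closed:
  "\<lbrakk>metric_connection A g D; X \<in> vector_fields A; Y \<in> vector_fields A\<rbrakk> \<Longrightarrow> D X Y \<in> vector_fields A"
  by (simp add: metric_connection_def linear_connection_def)

lemma metric_connectionD:
  assumes "metric_connection A g D"
    "X \<in> vector_fields A" "Y \<in> vector_fields A" "Z \<in> vector_fields A"
  shows "deriv_along X (g \<star> Y \<star> Z) = g \<star> D X Y \<star> Z + g \<star> Y \<star> D X Z"
proof -
  have "deriv_along X (g \<star> Y \<star> Z) - g \<star> D X Y \<star> Z - g \<star> Y \<star> D X Z = 0"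
    using assms by (simp add: metric_connection_def cov_deriv_02_def)
  then show ?thesis
    by (simp add: algebra_simps)
qed

text \<open>The difference \<open>B\<close> of the two connections satisfies \<open>B(X,Y) = B(Y,X)\<close>, and
  \<open>g(B(X,Y),Z)\<close> is skew in \<open>Y, Z\<close>; a trilinear form that is symmetric in the first two
  and skew in the last two arguments vanishes.\<close>

lemma metric_connection_unique:
  assumes D: "metric_connection A g D" and D': "metric_connection A g D'"
    and torsion: "\<And>X Y. \<lbrakk>X \<in> vector_fields A; Y \<in> vector_fields A\<rbrakk> \<Longrightarrow> torsion D X Y = torsion D' X Y"
    and X: "X \<in> vector_fields A" and Y: "Y \<in> vector_fields A"
  shows "D X Y = D' X Y"
proof -
  let ?B = "\<lambda>X Y. D X Y - D' X Y"
  note closed = metric_connection_closed[OF D] metric_connection_closed[OF D']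
  \<comment> \<open>The Lie bracket does not involve the connection and cancels between the two
    torsions.\<close>
  have sym: "?B X Y = ?B Y X" if "X \<in> vector_fields A" "Y \<in> vector_fields A" for X Y
    using torsion[OF that] by (simp add: torsion_def algebra_simps)
  have skew: "g \<star> ?B X Y \<star> Z = - (g \<star> ?B X Z \<star> Y)"
    if "X \<in> vector_fields A" "Y \<in> vector_fields A" "Z \<in> vector_fields A" for X Y Z
  proof -
    have "g \<star> D X Y \<star> Z + g \<star> Y \<star> D X Z = g \<star> D' X Y \<star> Z + g \<star> Y \<star> D' X Z"
      using metric_connectionD[OF D that] metric_connectionD[OF D' that] by simp
    with that show ?thesis
      by (simp add: closed g_sym[of Y] algebra_simps)
  qed
  have "?B X Y = 0"
  proof (rule g_nondegenerate)
    fix Z assume Z: "Z \<in> vector_fields A"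
    \<comment> \<open>With (XYZ) for g(B(X,Y),Z): (XYZ) = (YXZ) = -(YZX) = -(ZYX) = (ZXY) = (XZY) =
      -(XYZ).\<close>
    have "g \<star> ?B X Y \<star> Z = - (g \<star> ?B X Y \<star> Z)"
      by (metis X Y Z sym skew)
    then show "g \<star> ?B X Y \<star> Z = 0"
      by (simp add: fun_eq_iff)
  qed (use X Y in \<open>simp add: closed\<close>)
  then show ?thesis
    by simp
qed

lemma explicit_connection_is_generalized_symmetric:
  assumes smooth: "\<alpha> \<in> smooth_functions A" "\<beta> \<in> smooth_functions A"
    and D: "\<And>U V. \<lbrakk>U \<in> vector_fields A; V \<in> vector_fields A\<rbrakk> \<Longrightarrow> D U V = nabla U V
         + \<alpha> \<odot> ((\<eta> \<star> V) \<odot> U - (g \<star> U \<star> V) \<odot> \<xi>)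
         + \<beta> \<odot> ((\<eta> \<star> V) \<odot> (\<phi> \<star> U) - (g \<star> (\<phi> \<star> U) \<star> V) \<odot> \<xi>)"
  shows "generalized_symmetric_metric_connection A \<phi> \<eta> g \<alpha> \<beta> D"
proof -
  note pointwise = fscale_def tscale_def fun_eq_iff algebra_simps
  have nabla: "metric_connection A g nabla"
    and nabla_torsion: "\<And>U V. \<lbrakk>U \<in> vector_fields A; V \<in> vector_fields A\<rbrakk> \<Longrightarrow> torsion nabla U V = 0"
    using nabla_levi_civita by (simp_all add: levi_civita_connection_def)
  note nabla_closed [simp] = metric_connection_closed[OF nabla]
  have nabla_linear: "linear_connection A nabla"
    using nabla by (simp add: metric_connection_def)
  have closed: "D X Y \<in> vector_fields A" if "X \<in> vector_fields A" "Y \<in> vector_fields A" for X Y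
    using that smooth by (simp add: D)
  have linear: "linear_connection A D"
    unfolding linear_connection_def
  proof (intro conjI ballI)
    fix X Y Z assume XYZ [simp]: "X \<in> vector_fields A" "Y \<in> vector_fields A" "Z \<in> vector_fields A"
    have "nabla (X + Y) Z = nabla X Z + nabla Y Z"
      and "nabla X (Y + Z) = nabla X Y + nabla X Z"
      using nabla_linear by (simp_all add: linear_connection_def)
    then show "D (X + Y) Z = D X Z + D Y Z" "D X (Y + Z) = D X Y + D X Z"
      \<comment> \<open>First expand by linearity of the tensors on fields, then compare real
        numbers pointwise.\<close>
      by (simp_all add: D) (simp_all add: pointwise)
  next
    fix f X Y assume fXY [simp]: "f \<in> smooth_functions A" "X \<in> vector_fields A" "Y \<in> vector_fields A"
    have "nabla (f \<odot> X) Y = f \<odot> nabla X Y"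
      and "nabla X (f \<odot> Y) = deriv_along X f \<odot> Y + f \<odot> nabla X Y"
      using nabla_linear by (simp_all add: linear_connection_def)
    then show "D (f \<odot> X) Y = f \<odot> D X Y" "D X (f \<odot> Y) = deriv_along X f \<odot> Y + f \<odot> D X Y"
      by (simp_all add: D) (simp_all add: pointwise)
  qed (simp add: closed)
  \<comment> \<open>The \<open>nabla\<close> terms cancel by metricity, and the added terms by
    skewness in Y and Z.\<close>
  have "cov_deriv_02 D g X Y Z = 0"
    if "X \<in> vector_fields A" "Y \<in> vector_fields A" "Z \<in> vector_fields A" for X Y Z
    using that smooth
    by (simp add: cov_deriv_02_def D metric_connectionD[OF nabla] g_xi g_xi_left
        g_sym[of Y X] g_sym[of Y "\<phi> \<star> X"]) (simp add: pointwise)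
  moreover have "torsion D U V =
      \<alpha> \<odot> ((\<eta> \<star> V) \<odot> U - (\<eta> \<star> U) \<odot> V) +
      \<beta> \<odot> ((\<eta> \<star> V) \<odot> (\<phi> \<star> U) - (\<eta> \<star> U) \<odot> (\<phi> \<star> V))"
    if "U \<in> vector_fields A" "V \<in> vector_fields A" for U V
    using nabla_torsion[OF that] phi_self_adjoint[OF that] g_sym[OF that] that
    by (simp add: torsion_def D) (simp add: pointwise)
  ultimately show ?thesis
    using linear by (simp add: generalized_symmetric_metric_connection_def metric_connection_def)
qed

lemma generalized_symmetric_metric_connection_unique:
  assumes "generalized_symmetric_metric_connection A \<phi> \<eta> g \<alpha> \<beta> D"
    and "generalized_symmetric_metric_connection A \<phi> \<eta> g \<alpha> \<beta> D'"
    and "U \<in> vector_fields A" "V \<in> vector_fields A"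
  shows "D U V = D' U V"
proof (rule metric_connection_unique[of D D'])
  show "metric_connection A g D" "metric_connection A g D'"
    using assms(1,2) by (simp_all add: generalized_symmetric_metric_connection_def)
  show "torsion D X Y = torsion D' X Y" if "X \<in> vector_fields A" "Y \<in> vector_fields A" for X Y
    using assms(1,2) that by (simp add: generalized_symmetric_metric_connection_def)
qed (fact assms)+

end

theorem corollary1:
  fixes A :: "('a::{t2_space, second_countable_topology}, 'e::euclidean_space) atlas"
    and \<phi> :: "'a \<Rightarrow> 'a tvec \<Rightarrow> 'a tvec"
    and \<xi> :: "'a vfield"
    and \<eta> :: "'a \<Rightarrow> 'a tvec \<Rightarrow> real"
    and g :: "'a \<Rightarrow> 'a tvec \<Rightarrow> 'a tvec \<Rightarrow> real"
    and nabla nabla_bar :: "'a connection"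
    and \<alpha> \<beta> :: "'a \<Rightarrow> real"
  assumes "lp_sasakian_manifold A \<phi> \<xi> \<eta> g nabla"
    and "\<alpha> \<in> smooth_functions A" and "\<beta> \<in> smooth_functions A"
  shows "generalized_symmetric_metric_connection A \<phi> \<eta> g \<alpha> \<beta> nabla_bar \<longleftrightarrow>
    (\<forall>U\<in>vector_fields A. \<forall>V\<in>vector_fields A.
       nabla_bar U V = nabla U V
         + \<alpha> \<odot> ((\<eta> \<star> V) \<odot> U - (g \<star> U \<star> V) \<odot> \<xi>)
         + \<beta> \<odot> ((\<eta> \<star> V) \<odot> (\<phi> \<star> U) - (g \<star> (\<phi> \<star> U) \<star> V) \<odot> \<xi>))"
proof -
  interpret lp_sasakian_manifold A \<phi> \<xi> \<eta> g nabla
    by (fact assms(1))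
  let ?D = "\<lambda>U V. nabla U V
         + \<alpha> \<odot> ((\<eta> \<star> V) \<odot> U - (g \<star> U \<star> V) \<odot> \<xi>)
         + \<beta> \<odot> ((\<eta> \<star> V) \<odot> (\<phi> \<star> U) - (g \<star> (\<phi> \<star> U) \<star> V) \<odot> \<xi>)"
  have D: "generalized_symmetric_metric_connection A \<phi> \<eta> g \<alpha> \<beta> ?D"
    by (rule explicit_connection_is_generalized_symmetric[where D = ?D, OF assms(2,3) refl])
  show ?thesis
  proof
    assume "generalized_symmetric_metric_connection A \<phi> \<eta> g \<alpha> \<beta> nabla_bar"
    \<comment> \<open>\<open>nabla_bar\<close> and the explicit connection are both metric with the
      same torsion.\<close>
    from generalized_symmetric_metric_connection_unique[OF this D]
    show "\<forall>U\<in>vector_fields A. \<forall>V\<in>vector_fields A. nabla_bar U V = ?D U V"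
      by (intro ballI)
  next
    assume "\<forall>U\<in>vector_fields A. \<forall>V\<in>vector_fields A. nabla_bar U V = ?D U V"
    then show "generalized_symmetric_metric_connection A \<phi> \<eta> g \<alpha> \<beta> nabla_bar"
      by (intro explicit_connection_is_generalized_symmetric assms(2,3)) blast
  qed
qed

end
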